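(* Let $G$ be a connected graph on $q \ge 2$ vertices $v_1,\dots,v_q$, and let $M$ be its distance matrix, i.e. $M_{ij}=d(v_i,v_j)$. Define \[ r = r(G) = \min\left\{\frac{\max_i (Mw)_i - \min_i (Mw)_i}{\gcd_{i<j}\big((Mw)_i-(Mw)_j\big)} \;:\; w\in \mathbb{Z}^q,\ \sum_i w_i = 0,\ (Mw)_i \neq (Mw)_j \text{ for all } i\neq j\right\} + 1. \] Then for every $n \in \mathbb{N}$, the metric dimension $m(G,n)$ of $G^{\square n}$ satisfies \[ m(G,n) \le \left(2 + O\!\left(\frac{\log\log n}{\log n}\right)\right)\frac{n}{\log_r n}. \]
   Context: A set of vertices $S$ resolves a graph $H$ if every vertex of $H$ is uniquely determined by its vector of distances to the vertices in $S$; the metric dimension of $H$ is the minimum cardinality of a resolving set. The Cartesian product of graphs $G_1,\dots,G_n$ has vertex set $V(G_1)\times\dots\times V(G_n)$, with $(u_1,\dots,u_n)$ and $(v_1,\dots,v_n)$ adjacent iff there is $j$ with $u_i=v_i$ for all $i\ne j$ and $u_j$ adjacent to $v_j$ in $G_j$. $G^{\square n}$ denotes the Cartesian product of $n$ copies of $G$, and $m(G,n)$ its metric dimension. Equivalently, $S\subseteq V^n$ resolves $G^{\square n}$ iff the map $V^n\to\mathbb{N}^S$, $v\mapsto \big(\sum_{i=1}^n d(v_i,s_i)\big)_{s\in S}$, is injective. The $O(\cdot)$ term is as $n\to\infty$ with $G$ fixed. *)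

theory Defs
  imports
    Complex_Main
    "HOL-Library.FuncSet"
    "HOL-Library.Landau_Symbols"
    "Graph_Theory.Graph_Theory"
begin

text \<open>
  A finite simple graph is a \<open>pair_graph\<close>: a symmetric, loop-free arc relation on a finite
  vertex set.  The distance is the length of a shortest walk; it is meaningful only between
  vertices of the same component (for the graphs considered here: always).
\<close>

definition graph_dist :: "'a pair_pre_digraph \<Rightarrow> 'a \<Rightarrow> 'a \<Rightarrow> nat" where
  "graph_dist H u v =
     (LEAST k. \<exists>p. pre_digraph.awalk (with_proj H) u p v \<and> length p = k)"

definition resolves :: "'a pair_pre_digraph \<Rightarrow> 'a set \<Rightarrow> bool" where
  "resolves H S \<longleftrightarrow> S \<subseteq> pverts H \<and>
     (\<forall>u\<in>pverts H. \<forall>v\<in>pverts H.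
        (\<forall>s\<in>S. graph_dist H u s = graph_dist H v s) \<longrightarrow> u = v)"

definition metric_dimension :: "'a pair_pre_digraph \<Rightarrow> nat" where
  "metric_dimension H = (LEAST k. \<exists>S. resolves H S \<and> finite S \<and> card S = k)"

text \<open>
  Vertices of the product are extensional functions on the index set, so that tuples over \<open>I\<close>
  are represented uniquely.
\<close>

definition cartesian_product ::
    "'i set \<Rightarrow> ('i \<Rightarrow> 'a pair_pre_digraph) \<Rightarrow> ('i \<Rightarrow> 'a) pair_pre_digraph" where
  "cartesian_product I G =
     (let V = (\<Pi>\<^sub>E i\<in>I. pverts (G i)) in
      \<lparr> pverts = V,
        parcs = {(u, v). u \<in> V \<and> v \<in> V \<and>
          (\<exists>j\<in>I. (\<forall>i\<in>I - {j}. u i = v i) \<and> (u j, v j) \<in> parcs (G j))} \<rparr>)"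

definition cartesian_power :: "'a pair_pre_digraph \<Rightarrow> nat \<Rightarrow> (nat \<Rightarrow> 'a) pair_pre_digraph" where
  "cartesian_power G n = cartesian_product {1..n} (\<lambda>_. G)"

text \<open>
  The distance matrix is indexed by the vertices themselves rather than by an enumeration of
  them, and so are the vectors \<open>w\<close>; only the values of \<open>w\<close> on the vertex set matter.
\<close>

definition dist_matrix_mult :: "'a pair_pre_digraph \<Rightarrow> ('a \<Rightarrow> int) \<Rightarrow> 'a \<Rightarrow> int" where
  "dist_matrix_mult G w i = (\<Sum>j\<in>pverts G. int (graph_dist G i j) * w j)"

definition admissible_weight :: "'a pair_pre_digraph \<Rightarrow> ('a \<Rightarrow> int) \<Rightarrow> bool" where
  "admissible_weight G w \<longleftrightarrow>
     (\<Sum>i\<in>pverts G. w i) = 0 \<and>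
     (\<forall>i\<in>pverts G. \<forall>j\<in>pverts G. i \<noteq> j \<longrightarrow> dist_matrix_mult G w i \<noteq> dist_matrix_mult G w j)"

text \<open>
  The gcd ranges over all ordered pairs of distinct vertices; by symmetry under sign change this
  is the gcd over unordered pairs.
\<close>

definition spread_ratio :: "'a pair_pre_digraph \<Rightarrow> ('a \<Rightarrow> int) \<Rightarrow> real" where
  "spread_ratio G w =
     real_of_int (Max (dist_matrix_mult G w ` pverts G) - Min (dist_matrix_mult G w ` pverts G)) /
     real_of_int (Gcd {dist_matrix_mult G w i - dist_matrix_mult G w j | i j.
       i \<in> pverts G \<and> j \<in> pverts G \<and> i \<noteq> j})"

text \<open>
  The minimum over an infinite set of weights is a \<open>LEAST\<close>.  It is attained for a connected graph
  on at least two vertices: admissible weights then exist, and all ratios are positive integers.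
\<close>

definition r_param :: "'a pair_pre_digraph \<Rightarrow> real" where
  "r_param G = (LEAST x. \<exists>w. admissible_weight G w \<and> x = spread_ratio G w) + 1"

end

theory Submission
  imports Defs "HOL-Real_Asymp.Real_Asymp"
begin

text \<open>
  The construction is Lindstrom's, for the coin-weighing problem.  The rows are the members
  of a finite down-closed family of finite sets, and the coordinates of the power are labelled by
  pairs \<open>(T, i)\<close> with \<open>T\<close> in the family.  In the row \<open>X\<close>, the coordinate \<open>(T, i)\<close> is queried at a
  vertex that depends on \<open>X \<inter> T\<close> only, and the signs \<open>(-1)^|X|\<close> over \<open>X \<subseteq> T\<close> collect the distances
  to it into \<open>r^i (M w)_v\<close>; this is possible as long as \<open>2 r^i (\<Sum>x. w_x^+) \<le> 2^|T|\<close>, so that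
  almost \<open>|T| log_r 2\<close> coordinates carry the label \<open>T\<close>.  The alternating sum over the subsets of \<open>T\<close>
  annihilates the coordinates whose label does not contain \<open>T\<close>.  Hence if two vertices have equal
  distances to all rows, then for a maximal label \<open>T\<close> at which they differ only the coordinates
  labelled \<open>T\<close> survive, and these are recovered as the base-\<open>r\<close> digits of one number.

  For the family of all subsets of \<open>B\<close> disjoint \<open>k\<close>-element sets this gives about
  \<open>B 2^k (k/2) log_r 2\<close> coordinates for \<open>B 2^k\<close> rows.  Choosing \<open>2^k\<close> near \<open>n / (ln n)^2\<close> makes the cost of
  rounding \<open>B\<close> negligible.
\<close>

section \<open>Distances in Cartesian products\<close>

text \<open>Relation powers have composition laws and need no arc lists. The conjunct
  \<open>u \<in> pverts H\<close> matters for \<open>k = 0\<close>: the zeroth power relates every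
  element to itself, while an empty walk must sit at a vertex.\<close>

lemma awalk_length_iff_relpow:
  assumes "parcs H \<subseteq> pverts H \<times> pverts H"
  shows "(\<exists>p. pre_digraph.awalk (with_proj H) u p v \<and> length p = k)
    \<longleftrightarrow> u \<in> pverts H \<and> (u, v) \<in> parcs H ^^ k"
proof -
  interpret pair_wf_digraph H
    using assms by unfold_locales auto
  show ?thesis
  proof (induction k arbitrary: u)
    case 0
    then show ?case
      by (auto simp: awalk_Nil_iff)
  next
    case (Suc k)
    have "(\<exists>p. awalk u p v \<and> length p = Suc k)
      \<longleftrightarrow> (\<exists>z. (u, z) \<in> parcs H \<and> (\<exists>p. awalk z p v \<and> length p = k))"
    proof
      assume "\<exists>p. awalk u p v \<and> length p = Suc k"
      then obtain e p where "awalk u (e # p) v" "length p = k"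
        by (auto simp: length_Suc_conv)
      then show "\<exists>z. (u, z) \<in> parcs H \<and> (\<exists>p. awalk z p v \<and> length p = k)"
        by (cases e) (auto simp: awalk_Cons_iff)
    next
      assume "\<exists>z. (u, z) \<in> parcs H \<and> (\<exists>p. awalk z p v \<and> length p = k)"
      then obtain z p where "(u, z) \<in> parcs H" "awalk z p v" "length p = k"
        by blast
      then have "awalk u ((u, z) # p) v \<and> length ((u, z) # p) = Suc k"
        by (simp add: awalk_Cons_iff)
      then show "\<exists>p. awalk u p v \<and> length p = Suc k"
        by blast
    qed
    also have "\<dots> \<longleftrightarrow> (\<exists>z. (u, z) \<in> parcs H \<and> (z, v) \<in> parcs H ^^ k)"
      using Suc assms by blast
    also have "\<dots> \<longleftrightarrow> u \<in> pverts H \<and> (u, v) \<in> parcs H ^^ Suc k"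
      using assms relpow_Suc_I2[of u _ "parcs H" v k] relpow_Suc_D2[of u v k "parcs H"] by blast
    finally show ?case .
  qed
qed

lemma graph_dist_relpow:
  assumes "parcs H \<subseteq> pverts H \<times> pverts H" "u \<in> pverts H"
  shows "graph_dist H u v = (LEAST k. (u, v) \<in> parcs H ^^ k)"
  unfolding graph_dist_def awalk_length_iff_relpow[OF assms(1)] using assms(2) by simp

locale connected_pair_graph = pair_graph G for G :: "'a pair_pre_digraph" +
  assumes connected: "Digraph_Component.connected (with_proj G)"
begin

lemma arcs_subset: "parcs G \<subseteq> pverts G \<times> pverts G"
  by (auto dest: in_arcsD1 in_arcsD2)

lemma dist_relpow:
  assumes "u \<in> pverts G" "v \<in> pverts G"
  shows "(u, v) \<in> parcs G ^^ graph_dist G u v"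
proof -
  have "reachable (with_proj G) u v"
    using connected assms sym_arcs
    by (auto simp: connected_def strongly_connected_def reachable_mk_symmetric_eq)
  then obtain p where "awalk u p v"
    by (auto simp: reachable_awalk)
  then have "(u, v) \<in> parcs G ^^ length p"
    using awalk_length_iff_relpow[OF arcs_subset] by blast
  then show ?thesis
    unfolding graph_dist_relpow[OF arcs_subset assms(1)] by (rule LeastI)
qed

lemma dist_le:
  assumes "u \<in> pverts G" "(u, v) \<in> parcs G ^^ k"
  shows "graph_dist G u v \<le> k"
  unfolding graph_dist_relpow[OF arcs_subset assms(1)] using assms(2) by (rule Least_le)

lemma dist_self: "u \<in> pverts G \<Longrightarrow> graph_dist G u u = 0"
  using dist_le[of u u 0] by simp

lemma dist_pos:
  assumes "u \<in> pverts G" "v \<in> pverts G" "u \<noteq> v"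
  shows "graph_dist G u v > 0"
  using dist_relpow[OF assms(1,2)] assms(3) by (cases "graph_dist G u v") auto

lemma dist_step:
  assumes "u \<in> pverts G" "(v, z) \<in> parcs G"
  shows "graph_dist G u z \<le> Suc (graph_dist G u v)"
  using dist_relpow[of u v] assms arcs_subset
  by (intro dist_le) (auto intro!: relcompI)

end

lemma cartesian_product_arcs_subset:
  "parcs (cartesian_product I G) \<subseteq>
     pverts (cartesian_product I G) \<times> pverts (cartesian_product I G)"
  by (auto simp: cartesian_product_def Let_def)

lemma pverts_cartesian_product:
  "pverts (cartesian_product I G) = (\<Pi>\<^sub>E i\<in>I. pverts (G i))"
  by (simp add: cartesian_product_def Let_def)

text \<open>A walk in one factor lifts to the product by keeping all other coordinates of
  \<open>u\<close> fixed.\<close>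

lemma cartesian_product_relpow_coordinate:
  assumes "u \<in> pverts (cartesian_product I G)" "j \<in> I" "(u j, x) \<in> parcs (G j) ^^ k"
    "parcs (G j) \<subseteq> pverts (G j) \<times> pverts (G j)"
  shows "(u, u(j := x)) \<in> parcs (cartesian_product I G) ^^ k"
  using assms(3)
proof (induction k arbitrary: x)
  case 0
  then show ?case by (simp add: fun_upd_idem)
next
  case (Suc k)
  then obtain y where y: "(u j, y) \<in> parcs (G j) ^^ k" "(y, x) \<in> parcs (G j)"
    by auto
  have "(u(j := y), u(j := x)) \<in> parcs (cartesian_product I G)"
    using assms(1,2,4) y(2)
    by (auto simp: cartesian_product_def Let_def PiE_def extensional_def Pi_def split: if_splits
        intro!: bexI[of _ j])
  with Suc.IH[OF y(1)] show ?case
    by (rule relpow_Suc_I)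
qed

text \<open>An arc of the product moves one coordinate along one arc, so \<open>k\<close> arcs
  change the sum of the coordinate distances by at most \<open>k\<close>. Conversely, shortest walks
  in the factors, run one after another, attain the sum.\<close>

lemma graph_dist_cartesian_product:
  assumes "finite I" "\<And>i. i \<in> I \<Longrightarrow> connected_pair_graph (G i)"
    and u: "u \<in> pverts (cartesian_product I G)" and v: "v \<in> pverts (cartesian_product I G)"
  shows "graph_dist (cartesian_product I G) u v = (\<Sum>i\<in>I. graph_dist (G i) (u i) (v i))"
proof -
  let ?P = "cartesian_product I G"
  have lower: "(\<Sum>i\<in>I. graph_dist (G i) (u i) (x i)) \<le> k"
    if "(u, x) \<in> parcs ?P ^^ k" for k x
    using that
  proof (induction k arbitrary: x)
    case 0
    then show ?case
      using u connected_pair_graph.dist_self[OF assms(2)]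
      by (auto simp: pverts_cartesian_product PiE_iff)
  next
    case (Suc k)
    then obtain y where y: "(u, y) \<in> parcs ?P ^^ k" "(y, x) \<in> parcs ?P"
      by auto
    then obtain j where j: "j \<in> I" "\<forall>i\<in>I - {j}. y i = x i" "(y j, x j) \<in> parcs (G j)"
      by (auto simp: cartesian_product_def Let_def)
    have "graph_dist (G i) (u i) (x i) \<le> graph_dist (G i) (u i) (y i) + (if i = j then 1 else 0)"
      if "i \<in> I" for i
      using connected_pair_graph.dist_step[OF assms(2)[OF that]] u j that
      by (auto simp: pverts_cartesian_product)
    then have "(\<Sum>i\<in>I. graph_dist (G i) (u i) (x i))
        \<le> (\<Sum>i\<in>I. graph_dist (G i) (u i) (y i) + (if i = j then 1 else 0))"
      by (rule sum_mono)
    also have "\<dots> \<le> k + 1"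
      using Suc.IH[OF y(1)] assms(1) j(1) by (simp add: sum.distrib)
    finally show ?case by simp
  qed
  \<comment> \<open>\<open>A\<close> collects the coordinates already moved from \<open>u\<close> to
    \<open>v\<close>; each induction step moves one more.\<close>
  have upper: "(u, \<lambda>i. if i \<in> A then v i else u i)
      \<in> parcs ?P ^^ (\<Sum>i\<in>A. graph_dist (G i) (u i) (v i))" if "A \<subseteq> I" for A
    using finite_subset[OF that assms(1)] that
  proof (induction A rule: finite_induct)
    case empty
    then show ?case by simp
  next
    case (insert a A)
    let ?x = "\<lambda>i. if i \<in> A then v i else u i"
    have "?x \<in> pverts ?P"
      using u v insert.prems by (auto simp: pverts_cartesian_product PiE_iff extensional_def)
    moreover have "(?x a, v a) \<in> parcs (G a) ^^ graph_dist (G a) (u a) (v a)"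
      using insert u v connected_pair_graph.dist_relpow[OF assms(2)[of a]]
      by (auto simp: pverts_cartesian_product)
    ultimately have step: "(?x, ?x(a := v a)) \<in> parcs ?P ^^ graph_dist (G a) (u a) (v a)"
      using insert.prems connected_pair_graph.arcs_subset[OF assms(2)[of a]]
      by (intro cartesian_product_relpow_coordinate) auto
    have eq: "?x(a := v a) = (\<lambda>i. if i \<in> insert a A then v i else u i)"
      by auto
    have "(u, ?x) \<in> parcs ?P ^^ (\<Sum>i\<in>A. graph_dist (G i) (u i) (v i))"
      using insert by simp
    from relcompI[OF this step] show ?case
      using insert.hyps unfolding eq relpow_add[symmetric] by (simp add: add.commute)
  qed
  have "(\<lambda>i. if i \<in> I then v i else u i) = v"
    using u v by (auto simp: pverts_cartesian_product PiE_iff extensional_def)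
  with upper[OF subset_refl] have "(u, v) \<in> parcs ?P ^^ (\<Sum>i\<in>I. graph_dist (G i) (u i) (v i))"
    by simp
  then show ?thesis
    unfolding graph_dist_relpow[OF cartesian_product_arcs_subset u]
    by (intro Least_equality lower)
qed

lemma metric_dimension_le_card:
  assumes "resolves H S" "finite S"
  shows "metric_dimension H \<le> card S"
  unfolding metric_dimension_def using assms by (intro Least_le) blast

section \<open>Alternating sums over subsets\<close>

lemma sum_Pow_insert:
  fixes g :: "'b set \<Rightarrow> 'c::comm_monoid_add"
  assumes "finite A" "a \<notin> A"
  shows "(\<Sum>X\<in>Pow (insert a A). g X) = (\<Sum>X\<in>Pow A. g X + g (insert a X))"
proof -
  have "inj_on (insert a) (Pow A)"
    using assms(2) by (auto simp: inj_on_def)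
  then show ?thesis
    using assms unfolding Pow_insert
    by (subst sum.union_disjoint) (auto simp: sum.reindex sum.distrib)
qed

text \<open>Toggling \<open>a\<close> pairs up the subsets of \<open>T\<close>; the two members of a
  pair have opposite signs and the same value of \<open>g\<close>.\<close>

lemma alternating_sum_Pow_zero:
  fixes g :: "'b set \<Rightarrow> int"
  assumes "finite T" "a \<in> T" "\<And>X. X \<subseteq> T \<Longrightarrow> g (insert a X) = g X"
  shows "(\<Sum>X\<in>Pow T. (-1) ^ card X * g X) = 0"
proof -
  let ?A = "T - {a}"
  have "(\<Sum>X\<in>Pow (insert a ?A). (-1) ^ card X * g X)
      = (\<Sum>X\<in>Pow ?A. (-1) ^ card X * g X + (-1) ^ card (insert a X) * g (insert a X))"
    using assms(1) by (intro sum_Pow_insert) auto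
  also have "\<dots> = 0"
  proof (intro sum.neutral ballI)
    fix X assume "X \<in> Pow ?A"
    then have "card (insert a X) = Suc (card X)" "g (insert a X) = g X"
      using assms finite_subset[of X T] by (auto intro: card_insert_disjoint)
    then show "(-1) ^ card X * g X + (-1) ^ card (insert a X) * g (insert a X) = 0"
      by simp
  qed
  finally show ?thesis
    using assms(2) by (simp add: insert_absorb)
qed

text \<open>Complementation in \<open>A\<close> pairs sets whose sizes add up to
  \<open>card A\<close>.\<close>

lemma sum_Pow_card:
  assumes "finite A"
  shows "2 * (\<Sum>X\<in>Pow A. card X) = card A * 2 ^ card A"
proof -
  have "(\<Sum>X\<in>Pow A. card X) = (\<Sum>X\<in>Pow A. card (A - X))"
    by (rule sum.reindex_bij_witness[of _ "\<lambda>X. A - X" "\<lambda>X. A - X"]) (auto simp: double_diff)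
  then have "2 * (\<Sum>X\<in>Pow A. card X) = (\<Sum>X\<in>Pow A. card X + card (A - X))"
    by (simp add: sum.distrib)
  also have "\<dots> = (\<Sum>X\<in>Pow A. card A)"
    using assms by (intro sum.cong) (auto simp: card_Diff_subset finite_subset card_mono)
  finally show ?thesis
    using assms by (simp add: card_Pow)
qed

text \<open>\<open>F\<close> takes each value \<open>x\<close> with multiplicity \<open>p x\<close>;
  the indices left over in \<open>E\<close> are all sent to the default \<open>u\<close>, which
  accounts for the last summand.\<close>

lemma ex_multiplicity_function:
  fixes p :: "'a \<Rightarrow> nat"
  assumes "finite V" "finite E" "u \<in> V" "(\<Sum>x\<in>V. p x) \<le> card E"
  obtains F where "F \<in> E \<rightarrow> V"
    "\<And>h :: 'a \<Rightarrow> int. (\<Sum>X\<in>E. h (F X))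
      = (\<Sum>x\<in>V. int (p x) * h x) + int (card E - (\<Sum>x\<in>V. p x)) * h u"
proof -
  let ?d = "card E - (\<Sum>x\<in>V. p x)"
  define p' where "p' x = p x + (if x = u then ?d else 0)" for x
  let ?S = "SIGMA x:V. {..<p' x}"
  have "card ?S = card E"
    using assms by (simp add: p'_def sum.distrib)
  then obtain f where f: "bij_betw f E ?S"
    using assms by (metis finite_same_card_bij finite_SigmaI finite_lessThan)
  show ?thesis
  proof (rule that[of "fst \<circ> f"])
    show "fst \<circ> f \<in> E \<rightarrow> V"
      using bij_betwE[OF f] by fastforce
    fix h :: "'a \<Rightarrow> int"
    have "(\<Sum>X\<in>E. h ((fst \<circ> f) X)) = (\<Sum>y\<in>?S. h (fst y))"
      using sum.reindex_bij_betw[OF f, of "\<lambda>y. h (fst y)"] by simp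
    also have "\<dots> = (\<Sum>x\<in>V. \<Sum>i<p' x. h x)"
      using assms(1) by (subst sum.Sigma) (auto simp: split_def)
    also have "\<dots> = (\<Sum>x\<in>V. int (p x) * h x + (if x = u then int ?d * h x else 0))"
      by (intro sum.cong) (auto simp: p'_def algebra_simps)
    also have "\<dots> = (\<Sum>x\<in>V. int (p x) * h x) + int ?d * h u"
      using assms by (simp add: sum.distrib)
    finally show "(\<Sum>X\<in>E. h ((fst \<circ> f) X)) = (\<Sum>x\<in>V. int (p x) * h x) + int ?d * h u" .
  qed
qed

text \<open>The even subsets of \<open>T\<close> realise the positive part of \<open>c\<close> as
  multiplicities, the odd ones the negative part. Both parts have the same total since
  \<open>c\<close> sums to zero, and both parities occur equally often since \<open>T\<close> is
  nonempty. Hence the surplus at \<open>u\<close> is the same on both sides and cancels.\<close>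

lemma ex_function_alternating_sum:
  fixes c :: "'a \<Rightarrow> int"
  assumes "finite V" "u \<in> V" "finite T" "T \<noteq> {}"
    and "(\<Sum>x\<in>V. c x) = 0" "2 * (\<Sum>x\<in>V. nat (c x)) \<le> 2 ^ card T"
  obtains F where "F \<in> Pow T \<rightarrow> V"
    "\<And>h :: 'a \<Rightarrow> int. (\<Sum>X\<in>Pow T. (-1) ^ card X * h (F X)) = (\<Sum>x\<in>V. c x * h x)"
proof -
  define E where "E = {X \<in> Pow T. even (card X)}"
  define D where "D = {X \<in> Pow T. odd (card X)}"
  have fin: "finite E" "finite D" and ED: "Pow T = E \<union> D" "E \<inter> D = {}"
    using assms(3) by (auto simp: E_def D_def)
  have split: "(\<Sum>X\<in>Pow T. (-1) ^ card X * g X) = (\<Sum>X\<in>E. g X) - (\<Sum>X\<in>D. g X)"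
    for g :: "'b set \<Rightarrow> int"
  proof -
    have "(\<Sum>X\<in>Pow T. (-1) ^ card X * g X)
        = (\<Sum>X\<in>E. (-1) ^ card X * g X) + (\<Sum>X\<in>D. (-1) ^ card X * g X)"
      unfolding ED(1) using fin ED(2) by (rule sum.union_disjoint)
    also have "(\<Sum>X\<in>E. (-1) ^ card X * g X) = (\<Sum>X\<in>E. g X)"
      by (intro sum.cong) (auto simp: E_def)
    also have "(\<Sum>X\<in>D. (-1) ^ card X * g X) = (\<Sum>X\<in>D. - g X)"
      by (intro sum.cong) (auto simp: D_def)
    finally show ?thesis by (simp add: sum_negf)
  qed
  obtain a where "a \<in> T"
    using assms(4) by auto
  then have "(\<Sum>X\<in>Pow T. (-1) ^ card X * (1 :: int)) = 0"
    using assms(3) by (intro alternating_sum_Pow_zero) auto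
  then have eq: "card E = card D"
    unfolding split by simp
  moreover have "card E + card D = 2 ^ card T"
    using card_Un_disjoint[OF fin ED(2)] assms(3) by (simp add: ED(1)[symmetric] card_Pow)
  ultimately have le: "(\<Sum>x\<in>V. nat (c x)) \<le> card E"
    using assms(6) by simp
  have "int (\<Sum>x\<in>V. nat (c x)) - int (\<Sum>x\<in>V. nat (- c x)) = (\<Sum>x\<in>V. c x)"
    unfolding of_nat_sum sum_subtractf[symmetric] by (intro sum.cong) auto
  then have bal: "(\<Sum>x\<in>V. nat (- c x)) = (\<Sum>x\<in>V. nat (c x))"
    unfolding assms(5) by linarith
  obtain F where F: "F \<in> E \<rightarrow> V" "\<And>h :: 'a \<Rightarrow> int. (\<Sum>X\<in>E. h (F X))
      = (\<Sum>x\<in>V. int (nat (c x)) * h x) + int (card E - (\<Sum>x\<in>V. nat (c x))) * h u"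
    using ex_multiplicity_function[OF assms(1) fin(1) assms(2) le] by blast
  obtain F' where F': "F' \<in> D \<rightarrow> V" "\<And>h :: 'a \<Rightarrow> int. (\<Sum>X\<in>D. h (F' X))
      = (\<Sum>x\<in>V. int (nat (- c x)) * h x) + int (card D - (\<Sum>x\<in>V. nat (- c x))) * h u"
    using ex_multiplicity_function[OF assms(1) fin(2) assms(2), of "\<lambda>x. nat (- c x)"] le bal eq
    by auto
  let ?F = "\<lambda>X. if X \<in> E then F X else F' X"
  show ?thesis
  proof (rule that[of ?F])
    show "?F \<in> Pow T \<rightarrow> V"
      using F(1) F'(1) ED(1) by auto
    fix h :: "'a \<Rightarrow> int"
    have "(\<Sum>X\<in>D. h (?F X)) = (\<Sum>X\<in>D. h (F' X))"
      using ED(2) by (intro sum.cong) auto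
    then have "(\<Sum>X\<in>Pow T. (-1) ^ card X * h (?F X))
        = (\<Sum>x\<in>V. int (nat (c x)) * h x) - (\<Sum>x\<in>V. int (nat (- c x)) * h x)"
      unfolding split by (simp add: F(2) F'(2) bal eq)
    also have "\<dots> = (\<Sum>x\<in>V. c x * h x)"
      unfolding sum_subtractf[symmetric] by (intro sum.cong) auto
    finally show "(\<Sum>X\<in>Pow T. (-1) ^ card X * h (?F X)) = (\<Sum>x\<in>V. c x * h x)" .
  qed
qed

text \<open>Signed base-\<open>r\<close> digits, as they arise from subtracting two expansions. At
  the least exponent with a nonzero digit, all other terms are divisible by one more power of
  \<open>r\<close>, so \<open>r\<close> divides that digit, although its absolute value is positive
  and below \<open>r\<close>.\<close>

lemma digits_eq_zero:
  fixes d :: "'b \<Rightarrow> int" and r :: int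
  assumes "finite J" "inj_on e J" "\<And>j. j \<in> J \<Longrightarrow> \<bar>d j\<bar> < r" "(\<Sum>j\<in>J. r ^ e j * d j) = 0"
    and "j \<in> J"
  shows "d j = 0"
proof (rule ccontr)
  assume "d j \<noteq> 0"
  define B where "B = {j \<in> J. d j \<noteq> 0}"
  have B: "finite B" "B \<noteq> {}"
    using assms(1,5) \<open>d j \<noteq> 0\<close> by (auto simp: B_def)
  then obtain k where k: "k \<in> B" "\<And>i. i \<in> B \<Longrightarrow> e k \<le> e i"
    using ex_min_if_finite[of "e ` B"] by (metis (no_types) finite_imageI image_iff
        image_is_empty linorder_not_less)
  have "0 = (\<Sum>i\<in>B. r ^ e i * d i)"
    unfolding assms(4)[symmetric] using assms(1) by (intro sum.mono_neutral_right) (auto simp: B_def)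
  also have "\<dots> = r ^ e k * d k + (\<Sum>i\<in>B - {k}. r ^ e i * d i)"
    using B(1) k(1) by (rule sum.remove)
  finally have eq: "r ^ e k * d k = - (\<Sum>i\<in>B - {k}. r ^ e i * d i)"
    by simp
  have "r ^ Suc (e k) dvd (\<Sum>i\<in>B - {k}. r ^ e i * d i)"
  proof (rule dvd_sum)
    fix i assume i: "i \<in> B - {k}"
    then have "e i \<noteq> e k"
      using assms(2) k(1) by (auto simp: B_def inj_on_def)
    with k(2)[of i] i have "Suc (e k) \<le> e i"
      by simp
    then show "r ^ Suc (e k) dvd r ^ e i * d i"
      by (intro dvd_mult2 le_imp_power_dvd)
  qed
  then have dvd: "r ^ e k * r dvd r ^ e k * d k"
    unfolding eq by (simp add: mult.commute)
  have "r > 0"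
    using assms(3)[OF assms(5)] by linarith
  with dvd have "r dvd d k"
    by simp
  moreover have "\<bar>d k\<bar> < r" "d k \<noteq> 0"
    using k(1) assms(3) by (auto simp: B_def)
  ultimately show False
    using dvd_imp_le_int[of "d k" r] \<open>r > 0\<close> by simp
qed

section \<open>Resolving sets from down-closed families\<close>

context connected_pair_graph
begin

text \<open>\<open>m T\<close> is the number of coordinates that may carry the label
  \<open>T\<close>. The differences of \<open>M w\<close>, divided by \<open>g\<close>, are the
  signed digits in base \<open>r\<close>; the condition on \<open>m\<close> ensures that
  \<open>r ^ i * w\<close> can be realised by signs over the subsets of \<open>T\<close>.\<close>

lemma metric_dimension_cartesian_power_le:
  fixes w :: "'a \<Rightarrow> int" and \<F> :: "'b set set" and m :: "'b set \<Rightarrow> nat" and r :: nat and g :: int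
  assumes w: "admissible_weight G w" and g: "g > 0"
    and dvd: "\<And>x y. x \<in> pverts G \<Longrightarrow> y \<in> pverts G \<Longrightarrow>
      g dvd dist_matrix_mult G w x - dist_matrix_mult G w y"
    and less: "\<And>x y. x \<in> pverts G \<Longrightarrow> y \<in> pverts G \<Longrightarrow>
      dist_matrix_mult G w x - dist_matrix_mult G w y < g * int r"
    and fin: "finite \<F>" "\<And>T. T \<in> \<F> \<Longrightarrow> finite T"
    and down: "\<And>T X. T \<in> \<F> \<Longrightarrow> X \<subseteq> T \<Longrightarrow> X \<in> \<F>"
    and m: "\<And>T i. T \<in> \<F> \<Longrightarrow> i < m T \<Longrightarrow>
      T \<noteq> {} \<and> 2 * (\<Sum>x\<in>pverts G. nat (w x)) * r ^ i \<le> 2 ^ card T"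
    and n: "n \<le> (\<Sum>T\<in>\<F>. m T)" and ne: "pverts G \<noteq> {}"
  shows "metric_dimension (cartesian_power G n) \<le> card \<F>"
proof -
  let ?V = "pverts G" and ?d = "graph_dist G" and ?a = "dist_matrix_mult G w"
  let ?H = "cartesian_power G n"
  let ?C = "SIGMA T:\<F>. {..<m T}"
  have finV: "finite ?V" by (rule pair_finite_verts)
  have "card {1..n} \<le> card ?C"
    using fin(1) n by simp
  moreover have "finite ?C"
    using fin(1) by auto
  \<comment> \<open>\<open>\<phi> j\<close> is a pair: the label of coordinate \<open>j\<close> and
    its digit position.\<close>
  ultimately obtain \<phi> where \<phi>: "\<phi> ` {1..n} \<subseteq> ?C" "inj_on \<phi> {1..n}"
    using card_le_inj[of "{1..n}" ?C] by auto
  obtain u0 where u0: "u0 \<in> ?V"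
    using ne by auto
  have "\<forall>c\<in>?C. \<exists>F. F \<in> Pow (fst c) \<rightarrow> ?V \<and> (\<forall>h :: 'a \<Rightarrow> int.
      (\<Sum>X\<in>Pow (fst c). (-1) ^ card X * h (F X)) = int r ^ snd c * (\<Sum>x\<in>?V. w x * h x))"
  proof
    fix c assume "c \<in> ?C"
    then obtain T i where c: "c = (T, i)" "T \<in> \<F>" "i < m T"
      by auto
    have "(\<Sum>x\<in>?V. nat (int r ^ i * w x)) = (\<Sum>x\<in>?V. nat (w x)) * r ^ i"
      unfolding sum_distrib_right
      by (intro sum.cong refl) (simp add: nat_mult_distrib nat_power_eq)
    then have le: "2 * (\<Sum>x\<in>?V. nat (int r ^ i * w x)) \<le> 2 ^ card T"
      using m[OF c(2,3)] by (simp add: mult.assoc)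
    have z: "(\<Sum>x\<in>?V. int r ^ i * w x) = 0"
      using w unfolding sum_distrib_left[symmetric] by (simp add: admissible_weight_def)
    obtain F where F: "F \<in> Pow T \<rightarrow> ?V" "\<And>h :: 'a \<Rightarrow> int.
        (\<Sum>X\<in>Pow T. (-1) ^ card X * h (F X)) = (\<Sum>x\<in>?V. int r ^ i * w x * h x)"
      using ex_function_alternating_sum[OF finV u0 fin(2)[OF c(2)] _ z le] m[OF c(2,3)] by blast
    then show "\<exists>F. F \<in> Pow (fst c) \<rightarrow> ?V \<and> (\<forall>h :: 'a \<Rightarrow> int.
      (\<Sum>X\<in>Pow (fst c). (-1) ^ card X * h (F X)) = int r ^ snd c * (\<Sum>x\<in>?V. w x * h x))"
      unfolding c(1) by (intro exI[of _ F]) (simp add: sum_distrib_left mult.assoc)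
  qed
  from bchoice[OF this] obtain \<Phi> where \<Phi>: "\<And>c. c \<in> ?C \<Longrightarrow> \<Phi> c \<in> Pow (fst c) \<rightarrow> ?V"
    "\<And>c h. c \<in> ?C \<Longrightarrow> (\<Sum>X\<in>Pow (fst c). (-1) ^ card X * h (\<Phi> c X))
      = int r ^ snd c * (\<Sum>x\<in>?V. w x * h x)" for h :: "'a \<Rightarrow> int"
    by blast
  \<comment> \<open>Row \<open>X\<close> sees coordinate \<open>j\<close> only through the trace of
    \<open>X\<close> on its label; this makes elements outside the label irrelevant to that
    coordinate.\<close>
  define s where "s X = (\<lambda>j\<in>{1..n}. \<Phi> (\<phi> j) (X \<inter> fst (\<phi> j)))" for X
  have \<phi>C: "\<phi> j \<in> ?C" if "j \<in> {1..n}" for j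
    using \<phi>(1) that by blast
  have sV: "s X \<in> pverts ?H" for X
    unfolding cartesian_power_def pverts_cartesian_product s_def
    using \<Phi>(1)[OF \<phi>C] by (auto simp: Pi_def)
  have dist: "graph_dist ?H u (s X) = (\<Sum>j\<in>{1..n}. ?d (u j) (\<Phi> (\<phi> j) (X \<inter> fst (\<phi> j))))"
    if "u \<in> pverts ?H" for u X
    using graph_dist_cartesian_product[of "{1..n}" "\<lambda>_. G" u "s X"] that sV[of X]
    by (simp add: cartesian_power_def connected_pair_graph_axioms s_def)
  have "u = v" if u: "u \<in> pverts ?H" and v: "v \<in> pverts ?H"
    and eq: "\<forall>X\<in>\<F>. graph_dist ?H u (s X) = graph_dist ?H v (s X)" for u v
  proof (rule ccontr)
    assume "u \<noteq> v"
    have uV: "u j \<in> ?V" and vV: "v j \<in> ?V" if "j \<in> {1..n}" for j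
      using u v that unfolding cartesian_power_def pverts_cartesian_product by (auto simp: PiE_iff)
    define Bad where "Bad = {fst (\<phi> j) | j. j \<in> {1..n} \<and> u j \<noteq> v j}"
    have "Bad \<noteq> {}"
    proof
      assume "Bad = {}"
      then have "u j = v j" if "j \<in> {1..n}" for j
        using that by (auto simp: Bad_def)
      then show False
        using u v \<open>u \<noteq> v\<close> unfolding cartesian_power_def pverts_cartesian_product
        by (metis PiE_ext)
    qed
    have "Bad \<subseteq> \<F>"
      using \<phi>C by (force simp: Bad_def)
    then have "finite Bad"
      using fin(1) finite_subset by blast
    from finite_has_maximal[OF this \<open>Bad \<noteq> {}\<close>] obtain T where
      T: "T \<in> Bad" and max: "\<And>T'. T' \<in> Bad \<Longrightarrow> T \<subseteq> T' \<Longrightarrow> T' = T"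
      by auto
    have TF: "T \<in> \<F>" "finite T"
      using T \<open>Bad \<subseteq> \<F>\<close> fin(2) by auto
    define J where "J = {j \<in> {1..n}. fst (\<phi> j) = T}"
    define \<delta> where "\<delta> j X = int (?d (u j) (\<Phi> (\<phi> j) (X \<inter> fst (\<phi> j))))
      - int (?d (v j) (\<Phi> (\<phi> j) (X \<inter> fst (\<phi> j))))" for j X
    \<comment> \<open>Three cases. For the label \<open>T\<close>, the choice of
      \<open>\<Phi>\<close> yields a weighted digit. For a label strictly above \<open>T\<close>,
      maximality gives \<open>u j = v j\<close>. Otherwise some \<open>a \<in> T\<close> lies
      outside the label, \<open>\<delta> j\<close> ignores \<open>a\<close>, and the sum
      cancels.\<close>
    have inner: "(\<Sum>X\<in>Pow T. (-1) ^ card X * \<delta> j X)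
        = (if j \<in> J then int r ^ snd (\<phi> j) * (?a (u j) - ?a (v j)) else 0)"
      if j: "j \<in> {1..n}" for j
    proof (cases "j \<in> J")
      case True
      then have [simp]: "fst (\<phi> j) = T" by (simp add: J_def)
      have "(\<Sum>X\<in>Pow T. (-1) ^ card X * \<delta> j X) = (\<Sum>X\<in>Pow (fst (\<phi> j)). (-1) ^ card X *
          (\<lambda>x. int (?d (u j) x) - int (?d (v j) x)) (\<Phi> (\<phi> j) X))"
        by (intro sum.cong) (auto simp: \<delta>_def inf.absorb1)
      also have "\<dots> = int r ^ snd (\<phi> j) * (\<Sum>x\<in>?V. w x * (int (?d (u j) x) - int (?d (v j) x)))"
        by (rule \<Phi>(2)[OF \<phi>C[OF j]])
      also have "(\<Sum>x\<in>?V. w x * (int (?d (u j) x) - int (?d (v j) x))) = ?a (u j) - ?a (v j)"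
        unfolding dist_matrix_mult_def sum_subtractf[symmetric]
        by (intro sum.cong) (auto simp: algebra_simps)
      finally show ?thesis using True by simp
    next
      case False
      then have ne: "fst (\<phi> j) \<noteq> T" using j by (simp add: J_def)
      show ?thesis
      proof (cases "T \<subseteq> fst (\<phi> j)")
        case True
        then have "u j = v j"
          using max[of "fst (\<phi> j)"] ne j by (auto simp: Bad_def)
        then show ?thesis using False by (simp add: \<delta>_def)
      next
        case nsub: False
        then obtain a where "a \<in> T" "a \<notin> fst (\<phi> j)" by auto
        then have "(\<Sum>X\<in>Pow T. (-1) ^ card X * \<delta> j X) = 0"
          using TF(2) by (intro alternating_sum_Pow_zero) (auto simp: \<delta>_def)
        then show ?thesis using False by simp
      qed
    qed
    \<comment> \<open>Down-closedness makes every subset of \<open>T\<close> a row, so the equality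
      of distances applies to it.\<close>
    have "(\<Sum>j\<in>{1..n}. \<delta> j X) = 0" if "X \<in> Pow T" for X
    proof -
      have "X \<in> \<F>" using down[OF TF(1)] that by auto
      then have "(\<Sum>j\<in>{1..n}. ?d (u j) (\<Phi> (\<phi> j) (X \<inter> fst (\<phi> j))))
          = (\<Sum>j\<in>{1..n}. ?d (v j) (\<Phi> (\<phi> j) (X \<inter> fst (\<phi> j))))"
        using eq dist[OF u] dist[OF v] by simp
      then show ?thesis
        unfolding \<delta>_def sum_subtractf of_nat_sum[symmetric] by simp
    qed
    then have "0 = (\<Sum>X\<in>Pow T. (-1) ^ card X * (\<Sum>j\<in>{1..n}. \<delta> j X))"
      by simp
    also have "\<dots> = (\<Sum>j\<in>{1..n}. \<Sum>X\<in>Pow T. (-1) ^ card X * \<delta> j X)"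
      unfolding sum_distrib_left by (rule sum.swap)
    also have "\<dots> = (\<Sum>j\<in>{1..n}. if j \<in> J then int r ^ snd (\<phi> j) * (?a (u j) - ?a (v j)) else 0)"
      using inner by (rule sum.cong[OF refl])
    also have "\<dots> = (\<Sum>j\<in>J. int r ^ snd (\<phi> j) * (?a (u j) - ?a (v j)))"
      by (subst sum.inter_restrict[symmetric]) (auto simp: J_def intro!: sum.cong)
    also have "\<dots> = g * (\<Sum>j\<in>J. int r ^ snd (\<phi> j) * ((?a (u j) - ?a (v j)) div g))"
      unfolding sum_distrib_left
    proof (intro sum.cong refl)
      fix j assume "j \<in> J"
      then have "g dvd ?a (u j) - ?a (v j)"
        by (intro dvd uV vV) (auto simp: J_def)
      then obtain k where "?a (u j) - ?a (v j) = g * k" ..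
      then show "int r ^ snd (\<phi> j) * (?a (u j) - ?a (v j))
          = g * (int r ^ snd (\<phi> j) * ((?a (u j) - ?a (v j)) div g))"
        using g by simp
    qed
    finally have zero: "(\<Sum>j\<in>J. int r ^ snd (\<phi> j) * ((?a (u j) - ?a (v j)) div g)) = 0"
      using g by simp
    have inj: "inj_on (\<lambda>j. snd (\<phi> j)) J"
    proof (rule inj_onI)
      fix i j assume ij: "i \<in> J" "j \<in> J" "snd (\<phi> i) = snd (\<phi> j)"
      then have "\<phi> i = \<phi> j"
        by (intro prod_eqI) (auto simp: J_def)
      then show "i = j"
        using inj_onD[OF \<phi>(2)] ij by (auto simp: J_def)
    qed
    \<comment> \<open>The one-sided hypothesis \<open>less\<close> is used in both orders to bound
      the absolute value.\<close>
    have bound: "\<bar>(?a (u j) - ?a (v j)) div g\<bar> < int r" if "j \<in> J" for j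
    proof -
      have j: "j \<in> {1..n}" using that by (simp add: J_def)
      obtain k where k: "?a (u j) - ?a (v j) = g * k"
        using dvd[OF uV[OF j] vV[OF j]] ..
      have "g * k < g * int r" "g * (- k) < g * int r"
        using less[OF uV[OF j] vV[OF j]] less[OF vV[OF j] uV[OF j]] k by (auto simp: algebra_simps)
      then have "k < int r" "- k < int r"
        using mult_less_cancel_left_pos[OF g] by blast+
      then have "\<bar>k\<bar> < int r"
        by linarith
      then show ?thesis using k g by simp
    qed
    obtain j where j: "j \<in> {1..n}" "fst (\<phi> j) = T" "u j \<noteq> v j"
      using T by (auto simp: Bad_def)
    then have "j \<in> J" by (simp add: J_def)
    have "(?a (u j) - ?a (v j)) div g = 0"
      by (rule digits_eq_zero[OF _ inj bound zero \<open>j \<in> J\<close>]) (simp add: J_def)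
    then have "?a (u j) = ?a (v j)"
      using dvd[OF uV[OF j(1)] vV[OF j(1)]] g by (auto elim!: dvdE)
    then show False
      using w uV[OF j(1)] vV[OF j(1)] j(3) by (auto simp: admissible_weight_def)
  qed
  then have "resolves ?H (s ` \<F>)"
    using sV by (auto simp: resolves_def)
  then have "metric_dimension ?H \<le> card (s ` \<F>)"
    using fin(1) by (intro metric_dimension_le_card) auto
  also have "\<dots> \<le> card \<F>"
    using fin(1) by (rule card_image_le)
  finally show ?thesis .
qed

end

section \<open>Admissible weights\<close>

text \<open>A function that is not constant on \<open>V\<close> is a nonzero functional on the
  integer vectors of sum zero, and finitely many such functionals can be made nonzero at once. To
  repair a new constraint, a multiple of the old \<open>w\<close> is perturbed by the difference of
  the unit vectors at \<open>x\<close> and \<open>y\<close>, where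
  \<open>a x \<noteq> a y\<close>.\<close>

lemma ex_weight_nonorthogonal:
  fixes A :: "('a \<Rightarrow> int) set"
  assumes "finite V" "finite A" "\<And>a. a \<in> A \<Longrightarrow> \<exists>x\<in>V. \<exists>y\<in>V. a x \<noteq> a y"
  shows "\<exists>w. (\<Sum>z\<in>V. w z) = (0 :: int) \<and> (\<forall>a\<in>A. (\<Sum>z\<in>V. a z * w z) \<noteq> 0)"
  using assms(2,3)
proof (induction A rule: finite_induct)
  case empty
  show ?case by (intro exI[of _ "\<lambda>_. 0"]) simp
next
  case (insert a A)
  then obtain w where w: "(\<Sum>z\<in>V. w z) = 0" "\<forall>a\<in>A. (\<Sum>z\<in>V. a z * w z) \<noteq> 0"
    by auto
  show ?case
  proof (cases "(\<Sum>z\<in>V. a z * w z) = 0")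
    case False
    with w show ?thesis by blast
  next
    case True
    obtain x y where xy: "x \<in> V" "y \<in> V" "a x \<noteq> a y"
      using insert.prems[of a] by auto
    \<comment> \<open>\<open>t\<close> is so large that \<open>t * w\<close> dominates the perturbation in each constraint already satisfied.\<close>
    define t where "t = 1 + (\<Sum>b\<in>A. \<bar>b x - b y\<bar>)"
    define w' where "w' z = t * w z + ((if z = x then 1 else 0) - (if z = y then 1 else 0))" for z
    have sum: "(\<Sum>z\<in>V. b z * w' z) = t * (\<Sum>z\<in>V. b z * w z) + (b x - b y)" for b
    proof -
      have "(\<Sum>z\<in>V. b z * w' z) = (\<Sum>z\<in>V. t * (b z * w z)
          + ((if z = x then b z else 0) - (if z = y then b z else 0)))"
        by (intro sum.cong) (auto simp: w'_def algebra_simps)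
      then show ?thesis
        using assms(1) xy by (simp add: sum.distrib sum_subtractf sum_distrib_left)
    qed
    have "(\<Sum>z\<in>V. w' z) = 0"
      using sum[of "\<lambda>_. 1"] w(1) by simp
    moreover have "(\<Sum>z\<in>V. b z * w' z) \<noteq> 0" if "b \<in> insert a A" for b
    proof (cases "b = a")
      case True
      with \<open>(\<Sum>z\<in>V. a z * w z) = 0\<close> xy show ?thesis by (simp add: sum)
    next
      case False
      with that have b: "b \<in> A" by simp
      let ?B = "\<Sum>z\<in>V. b z * w z"
      have "\<bar>b x - b y\<bar> \<le> (\<Sum>b\<in>A. \<bar>b x - b y\<bar>)"
        using insert.hyps(1) b by (intro member_le_sum) auto
      then have "\<bar>b x - b y\<bar> < t"
        by (simp add: t_def)
      also have "t * 1 \<le> t * \<bar>?B\<bar>"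
        using w(2) b \<open>\<bar>b x - b y\<bar> < t\<close> by (intro mult_left_mono) auto
      then have "t \<le> \<bar>t * ?B\<bar>"
        using \<open>\<bar>b x - b y\<bar> < t\<close> by (simp add: abs_mult)
      finally show ?thesis
        unfolding sum by linarith
    qed
    ultimately show ?thesis by blast
  qed
qed

context connected_pair_graph
begin

text \<open>The difference of rows \<open>i\<close> and \<open>j\<close> of the distance matrix is
  negative at \<open>i\<close> and positive at \<open>j\<close>, hence not constant.\<close>

lemma ex_admissible_weight: "\<exists>w. admissible_weight G w"
proof -
  let ?V = "pverts G"
  define A where "A = (\<lambda>(i, j) z. int (graph_dist G i z) - int (graph_dist G j z)) `
    {(i, j). i \<in> ?V \<and> j \<in> ?V \<and> i \<noteq> j}"
  have "finite {(i, j). i \<in> ?V \<and> j \<in> ?V \<and> i \<noteq> j}"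
    by (rule finite_subset[of _ "?V \<times> ?V"]) (auto simp: pair_finite_verts)
  then have "finite A"
    unfolding A_def by (rule finite_imageI)
  moreover have "\<exists>x\<in>?V. \<exists>y\<in>?V. a x \<noteq> a y" if a: "a \<in> A" for a
  proof -
    obtain i j where ij: "i \<in> ?V" "j \<in> ?V" "i \<noteq> j"
      "a = (\<lambda>z. int (graph_dist G i z) - int (graph_dist G j z))"
      using a by (auto simp: A_def)
    then have "a i < a j"
      using dist_pos[of i j] dist_pos[of j i] by (simp add: dist_self)
    with ij(1,2) show ?thesis
      by (metis less_irrefl)
  qed
  ultimately obtain w where w: "(\<Sum>z\<in>?V. w z) = 0" "\<forall>a\<in>A. (\<Sum>z\<in>?V. a z * w z) \<noteq> 0"
    using ex_weight_nonorthogonal[OF pair_finite_verts] by blast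
  have "dist_matrix_mult G w i \<noteq> dist_matrix_mult G w j"
    if "i \<in> ?V" "j \<in> ?V" "i \<noteq> j" for i j
  proof -
    let ?a = "\<lambda>z. int (graph_dist G i z) - int (graph_dist G j z)"
    have "?a \<in> A"
      using that by (auto simp: A_def)
    from bspec[OF w(2) this] show ?thesis
      by (simp add: dist_matrix_mult_def left_diff_distrib sum_subtractf)
  qed
  with w(1) show ?thesis
    by (auto simp: admissible_weight_def)
qed

text \<open>\<open>g\<close> is the gcd. The spread is itself the difference of two entries of
  \<open>M w\<close>, so \<open>g\<close> divides it and the ratio \<open>\<rho>\<close> is a
  positive integer.\<close>

lemma spread_ratio_nat:
  assumes "card (pverts G) \<ge> 2" and w: "admissible_weight G w"
  obtains g \<rho> where "g > 0" "\<rho> \<ge> 1" "spread_ratio G w = real \<rho>"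
    "\<And>x y. x \<in> pverts G \<Longrightarrow> y \<in> pverts G \<Longrightarrow>
      g dvd dist_matrix_mult G w x - dist_matrix_mult G w y"
    "\<And>x y. x \<in> pverts G \<Longrightarrow> y \<in> pverts G \<Longrightarrow>
      dist_matrix_mult G w x - dist_matrix_mult G w y \<le> g * int \<rho>"
proof -
  let ?V = "pverts G" and ?a = "dist_matrix_mult G w"
  let ?D = "{?a i - ?a j | i j. i \<in> ?V \<and> j \<in> ?V \<and> i \<noteq> j}"
  let ?M = "Max (?a ` ?V)" and ?m = "Min (?a ` ?V)"
  obtain p q where pq: "p \<in> ?V" "q \<in> ?V" "p \<noteq> q"
    using assms(1) card_le_Suc0_iff_eq[OF pair_finite_verts] by (auto simp: not_le[symmetric])
  have inj: "?a i \<noteq> ?a j" if "i \<in> ?V" "j \<in> ?V" "i \<noteq> j" for i j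
    using w that by (auto simp: admissible_weight_def)
  have fin: "finite (?a ` ?V)" "?a ` ?V \<noteq> {}"
    using pair_finite_verts pq by auto
  have "?a p - ?a q \<in> ?D"
    using pq by blast
  moreover have "?a p - ?a q \<noteq> 0"
    using inj pq by simp
  ultimately have "\<not> ?D \<subseteq> {0}"
    by blast
  then have "Gcd ?D \<noteq> 0"
    by (simp only: Gcd_0_iff not_False_eq_True)
  moreover have "Gcd ?D \<ge> 0"
    by simp
  ultimately have g: "Gcd ?D > 0"
    by linarith
  have dvd: "Gcd ?D dvd ?a x - ?a y" if "x \<in> ?V" "y \<in> ?V" for x y
  proof (cases "x = y")
    case False
    with that show ?thesis by (intro Gcd_dvd) blast
  qed simp
  obtain x y where xy: "x \<in> ?V" "y \<in> ?V" "?M = ?a x" "?m = ?a y"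
    using Max_in[OF fin] Min_in[OF fin] by auto
  obtain k where k: "?M - ?m = Gcd ?D * k"
    using dvd[OF xy(1,2)] xy(3,4) by (auto elim: dvdE)
  have le: "?a i - ?a j \<le> ?M - ?m" if "i \<in> ?V" "j \<in> ?V" for i j
    using Max_ge[OF fin(1) imageI[OF that(1)]] Min_le[OF fin(1) imageI[OF that(2)]] by linarith
  have "0 < ?M - ?m"
    using le[OF pq(1,2)] le[OF pq(2,1)] inj[OF pq] by linarith
  then have "k > 0"
    unfolding k using g by (simp add: zero_less_mult_iff)
  show ?thesis
  proof (rule that[of "Gcd ?D" "nat k"])
    have "real_of_int (d * k) / real_of_int d = real (nat k)" if "d > 0" for d
      using that \<open>k > 0\<close> by simp
    then show "spread_ratio G w = real (nat k)"
      unfolding spread_ratio_def k using g by blast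
    show "?a i - ?a j \<le> Gcd ?D * int (nat k)" if "i \<in> ?V" "j \<in> ?V" for i j
      using le[OF that] k \<open>k > 0\<close> by simp
  qed (use g dvd \<open>k > 0\<close> in auto)
qed

text \<open>A \<open>LEAST\<close> over the reals need not be attained. Since all ratios are natural
  numbers, it coincides with the least natural number satisfying \<open>Q\<close>.\<close>

lemma r_param_attained:
  assumes "card (pverts G) \<ge> 2"
  obtains w where "admissible_weight G w" "r_param G = spread_ratio G w + 1"
proof -
  define Q where "Q k \<longleftrightarrow> (\<exists>w. admissible_weight G w \<and> spread_ratio G w = real k)" for k
  obtain w where "admissible_weight G w"
    using ex_admissible_weight by blast
  moreover from this obtain k where "spread_ratio G w = real k"
    by (rule spread_ratio_nat[OF assms])
  ultimately have "Q k"
    by (auto simp: Q_def)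
  then have "Q (LEAST k. Q k)"
    by (rule LeastI)
  then obtain w where w: "admissible_weight G w" "spread_ratio G w = real (LEAST k. Q k)"
    by (auto simp: Q_def)
  have "(LEAST x. \<exists>w. admissible_weight G w \<and> x = spread_ratio G w) = spread_ratio G w"
  proof (rule Least_equality)
    fix x assume "\<exists>w. admissible_weight G w \<and> x = spread_ratio G w"
    then obtain w' where w': "admissible_weight G w'" "x = spread_ratio G w'"
      by blast
    obtain k where k: "spread_ratio G w' = real k"
      by (rule spread_ratio_nat[OF assms w'(1)])
    with w'(1) have "(LEAST k. Q k) \<le> k"
      by (intro Least_le) (auto simp: Q_def)
    then show "spread_ratio G w \<le> x"
      using w(2) w'(2) k by simp
  qed (use w(1) in blast)
  then show ?thesis
    using that w(1) by (simp add: r_param_def)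
qed

end

section \<open>Asymptotics\<close>

text \<open>The denominator is \<open>c / 2 * log 2 n\<close> up to a term of order
  \<open>ln (ln n)\<close>, so the first quotient tends to 2 with the stated error; the second
  summand contributes only order \<open>1 / ln n\<close>.\<close>

lemma blocking_error_bigo:
  fixes c C :: real
  assumes "c > 0"
  shows "(\<lambda>n. c * (ln (real n) / ln 2) * (1 / (c / 2 * (ln (real n / ln (real n) ^ 2) / ln 2 - 1) - C)
      + 1 / ln (real n) ^ 2) - 2) \<in> O(\<lambda>n. ln (ln (real n)) / ln (real n))"
  using assms by real_asymp

lemma eventually_block_size_positive:
  fixes c C :: real
  assumes "c > 0"
  shows "eventually (\<lambda>n. c / 2 * (ln (real n / ln (real n) ^ 2) / ln 2 - 1) - C > 0) sequentially"
  using assms by real_asymp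

lemma eventually_log_block_nonneg:
  "eventually (\<lambda>n. ln (real n / ln (real n) ^ 2) / ln 2 \<ge> 0) sequentially"
  by real_asymp

section \<open>Families built from disjoint blocks\<close>

text \<open>The power sets of disjoint blocks share only the empty set, whose multiplicity is
  zero.\<close>

lemma sum_UN_Pow_disjoint:
  fixes m :: "'b set \<Rightarrow> nat"
  assumes "finite I" "\<And>i. i \<in> I \<Longrightarrow> finite (A i)" "disjoint_family_on A I" "m {} = 0"
  shows "(\<Sum>T\<in>(\<Union>i\<in>I. Pow (A i)). m T) = (\<Sum>i\<in>I. \<Sum>T\<in>Pow (A i). m T)"
proof -
  have disj: "(Pow (A i) - {{}}) \<inter> (Pow (A j) - {{}}) = {}" if "i \<in> I" "j \<in> I" "i \<noteq> j" for i j
  proof -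
    have "Pow (A i) \<inter> Pow (A j) = {{}}"
      using disjoint_family_onD[OF assms(3) that] by (simp flip: Pow_Int_eq)
    then show ?thesis by blast
  qed
  have "(\<Sum>T\<in>(\<Union>i\<in>I. Pow (A i)). m T) = (\<Sum>T\<in>(\<Union>i\<in>I. Pow (A i) - {{}}). m T)"
    using assms by (intro sum.mono_neutral_right) auto
  also have "\<dots> = (\<Sum>i\<in>I. \<Sum>T\<in>Pow (A i) - {{}}. m T)"
    using assms(1,2) disj by (intro sum.UNION_disjoint) auto
  also have "\<dots> = (\<Sum>i\<in>I. \<Sum>T\<in>Pow (A i). m T)"
    using assms(2,4) by (intro sum.cong sum.mono_neutral_left) auto
  finally show ?thesis .
qed

context connected_pair_graph
begin

text \<open>The family consists of all subsets of \<open>B\<close> disjoint blocks of size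
  \<open>k\<close>. A subset of a block has average size \<open>k / 2\<close> and carries about
  \<open>log r 2\<close> coordinates per element; the constant \<open>C\<close> absorbs the
  weight.\<close>

lemma metric_dimension_block_bound:
  assumes "card (pverts G) \<ge> 2"
  obtains C where "r_param G > 1"
    "\<And>n B k. real n \<le> real B * 2 ^ k * (log (r_param G) 2 / 2 * real k - C) \<Longrightarrow>
      metric_dimension (cartesian_power G n) \<le> B * 2 ^ k"
proof -
  let ?V = "pverts G"
  obtain w where w: "admissible_weight G w" and rw: "r_param G = spread_ratio G w + 1"
    using r_param_attained[OF assms] by blast
  obtain g \<rho> where g: "g > 0" and \<rho>: "\<rho> \<ge> 1" "spread_ratio G w = real \<rho>"
    and dvd: "\<And>x y. x \<in> ?V \<Longrightarrow> y \<in> ?V \<Longrightarrow>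
      g dvd dist_matrix_mult G w x - dist_matrix_mult G w y"
    and le: "\<And>x y. x \<in> ?V \<Longrightarrow> y \<in> ?V \<Longrightarrow>
      dist_matrix_mult G w x - dist_matrix_mult G w y \<le> g * int \<rho>"
    using spread_ratio_nat[OF assms w] by blast
  \<comment> \<open>The successor turns the bound by \<open>g * \<rho>\<close> into the strict bound
    that signed digits require.\<close>
  define r where "r = Suc \<rho>"
  have r: "r_param G = real r" "real r > 1"
    using rw \<rho> by (auto simp: r_def)
  define W where "W = (\<Sum>x\<in>?V. nat (w x))"
  define c where "c = log r 2"
  \<comment> \<open>The summand 1 makes the logarithm positive whatever \<open>W\<close> is;
    \<open>C > 0\<close> in turn forces \<open>m {} = 0\<close>.\<close>
  define C where "C = log r (2 * (real W + 1))"
  have "C > 0"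
    using r(2) by (simp add: C_def)
  have less: "dist_matrix_mult G w x - dist_matrix_mult G w y < g * int r"
    if "x \<in> ?V" "y \<in> ?V" for x y
    using le[OF that] g by (simp add: r_def algebra_simps)
  show ?thesis
  proof (rule that)
    show "r_param G > 1" using r by simp
    fix n B k :: nat
    assume n: "real n \<le> real B * 2 ^ k * (log (r_param G) 2 / 2 * real k - C)"
    define A where "A b = {b} \<times> {..<k}" for b :: nat
    define \<F> where "\<F> = (\<Union>b\<in>{..<B}. Pow (A b))"
    \<comment> \<open>This counts the \<open>i\<close> with
      \<open>2 * (W + 1) * r ^ i < 2 ^ card T\<close>. Truncation at zero only enlarges the sum over
      a block.\<close>
    define m where "m T = nat \<lceil>c * real (card T) - C\<rceil>" for T :: "(nat \<times> nat) set"
    have cardA: "card (A b) = k" "finite (A b)" for b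
      by (auto simp: A_def card_cartesian_product)
    have m_less: "T \<noteq> {} \<and> 2 * (\<Sum>x\<in>?V. nat (w x)) * r ^ i \<le> 2 ^ card T" if "i < m T" for i T
    proof
      have i: "real i < c * real (card T) - C"
        using that by (simp add: m_def zless_nat_eq_int_zless less_ceiling_iff)
      then show "T \<noteq> {}"
        using \<open>C > 0\<close> by auto
      have "real (2 * W * r ^ i) \<le> 2 * (real W + 1) * real r ^ i"
        by (simp add: algebra_simps)
      also have "\<dots> = real r powr (real i + C)"
        using r(2) by (simp add: C_def powr_add powr_realpow)
      also have "\<dots> \<le> real r powr (c * real (card T))"
        using i r(2) by (intro powr_mono) auto
      also have "\<dots> = real (2 ^ card T)"
        using r(2) by (simp add: c_def powr_powr[symmetric] powr_realpow)
      finally show "2 * (\<Sum>x\<in>?V. nat (w x)) * r ^ i \<le> 2 ^ card T"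
        unfolding W_def of_nat_le_iff .
    qed
    have block: "2 ^ k * (c / 2 * real k - C) \<le> real (\<Sum>T\<in>Pow (A b). m T)" for b
    proof -
      have "2 * real (\<Sum>T\<in>Pow (A b). card T) = real k * 2 ^ k"
        using arg_cong[OF sum_Pow_card[OF cardA(2)], of real b] by (simp add: cardA)
      then have "2 ^ k * (c / 2 * real k - C) = c * real (\<Sum>T\<in>Pow (A b). card T) - C * 2 ^ k"
        by (simp add: algebra_simps)
      also have "\<dots> = (\<Sum>T\<in>Pow (A b). c * real (card T) - C)"
        by (simp add: sum_subtractf sum_distrib_left card_Pow cardA)
      also have "\<dots> \<le> (\<Sum>T\<in>Pow (A b). real (m T))"
        unfolding m_def by (intro sum_mono real_nat_ceiling_ge)
      finally show ?thesis by simp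
    qed
    have "real n \<le> (\<Sum>b<B. 2 ^ k * (c / 2 * real k - C))"
      using n by (simp add: c_def r(1) mult.assoc)
    also have "\<dots> \<le> (\<Sum>b<B. real (\<Sum>T\<in>Pow (A b). m T))"
      using block by (rule sum_mono)
    also have "\<dots> = real (\<Sum>T\<in>\<F>. m T)"
    proof -
      have "(\<Sum>T\<in>\<F>. m T) = (\<Sum>b<B. \<Sum>T\<in>Pow (A b). m T)"
        unfolding \<F>_def using \<open>C > 0\<close> cardA
        by (intro sum_UN_Pow_disjoint) (auto simp: disjoint_family_on_def A_def m_def)
      then show ?thesis by simp
    qed
    finally have "n \<le> (\<Sum>T\<in>\<F>. m T)"
      unfolding of_nat_le_iff .
    moreover have "finite \<F>"
      using cardA(2) by (simp add: \<F>_def)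
    moreover have "finite T" if "T \<in> \<F>" for T
      using that cardA(2) finite_subset by (auto simp: \<F>_def)
    moreover have "X \<in> \<F>" if "T \<in> \<F>" "X \<subseteq> T" for T X
      using that by (auto simp: \<F>_def)
    moreover have "?V \<noteq> {}"
      using assms by auto
    ultimately have "metric_dimension (cartesian_power G n) \<le> card \<F>"
      using m_less by (intro metric_dimension_cartesian_power_le[OF w g dvd less])
    also have "\<dots> \<le> (\<Sum>b<B. card (Pow (A b)))"
      unfolding \<F>_def by (rule card_UN_le) simp
    also have "\<dots> = B * 2 ^ k"
      by (simp add: card_Pow cardA)
    finally show "metric_dimension (cartesian_power G n) \<le> B * 2 ^ k" .
  qed
qed

end

section \<open>Choice of the block size and the error term\<close>

theorem theorem2p1:
  fixes G :: "'a pair_pre_digraph"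
  assumes "pair_graph G"
    and "Digraph_Component.connected (with_proj G)"
    and "card (pverts G) \<ge> 2"
  shows "\<exists>f :: nat \<Rightarrow> real. f \<in> O(\<lambda>n. ln (ln (real n)) / ln (real n)) \<and>
    (\<forall>n\<ge>2. real (metric_dimension (cartesian_power G n))
       \<le> (2 + f n) * (real n / log (r_param G) (real n)))"
proof -
  interpret connected_pair_graph G
    using assms(1,2) by (simp add: connected_pair_graph_def connected_pair_graph_axioms_def)
  let ?dim = "\<lambda>n. real (metric_dimension (cartesian_power G n))"
  let ?r = "r_param G"
  obtain C where r: "?r > 1"
    and bound: "\<And>n B k. real n \<le> real B * 2 ^ k * (log ?r 2 / 2 * real k - C) \<Longrightarrow>
      metric_dimension (cartesian_power G n) \<le> B * 2 ^ k"
    using metric_dimension_block_bound[OF assms(3)] by blast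
  define c where "c = log ?r 2"
  have "c > 0"
    using r by (simp add: c_def)
  have log_r: "log ?r (real n) = c * (ln (real n) / ln 2)" for n
    by (simp add: c_def log_def)
  define L where "L n = ln (real n / ln (real n) ^ 2) / ln 2" for n :: nat
  \<comment> \<open>A lower bound for the yield \<open>c / 2 * k - C\<close> of a block per row,
    free of the rounding in \<open>k\<close>.\<close>
  define D where "D n = c / 2 * (L n - 1) - C" for n
  define E where "E n = c * (ln (real n) / ln 2) * (1 / D n + 1 / ln (real n) ^ 2) - 2" for n
  \<comment> \<open>The least nonnegative error for which the bound holds, so only its growth
    remains to be shown; being truncated at 0, it satisfies
    \<open>\<bar>f n\<bar> \<le> \<bar>E n\<bar>\<close> once the untruncated value is at most
    \<open>E n\<close>.\<close>
  define f where "f n = max 0 (?dim n * log ?r (real n) / real n - 2)" for n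
  have "eventually (\<lambda>n. \<bar>f n\<bar> \<le> \<bar>E n\<bar>) sequentially"
    using eventually_block_size_positive[OF \<open>c > 0\<close>, of C] eventually_log_block_nonneg
      eventually_ge_at_top[of 2]
    unfolding L_def[symmetric] D_def[symmetric]
  proof eventually_elim
    case (elim n)
    define k where "k = nat \<lfloor>L n\<rfloor>"
    \<comment> \<open>The fewest blocks that hold \<open>n\<close> coordinates at yield
      \<open>D n\<close>. Rounding up costs at most one block of \<open>2 ^ k\<close> rows, and
      \<open>k \<le> L n\<close> keeps this below \<open>n / ln n ^ 2\<close>.\<close>
    define B where "B = nat \<lceil>real n / (2 ^ k * D n)\<rceil>"
    have k: "real k \<le> L n" "L n - 1 \<le> real k"
      using elim(2) by (auto simp: k_def)
    have lnn: "ln (real n) > 0"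
      using elim(3) by simp
    have "real n = real n / (2 ^ k * D n) * 2 ^ k * D n"
      using elim(1) by simp
    also have "\<dots> \<le> real B * 2 ^ k * D n"
      unfolding B_def using elim(1) by (intro mult_right_mono real_nat_ceiling_ge) auto
    also have "\<dots> \<le> real B * 2 ^ k * (c / 2 * real k - C)"
      unfolding D_def using k(2) \<open>c > 0\<close> by (intro mult_left_mono diff_right_mono) auto
    finally have "metric_dimension (cartesian_power G n) \<le> B * 2 ^ k"
      unfolding c_def by (rule bound)
    then have "?dim n \<le> real (B * 2 ^ k)"
      by (rule of_nat_mono)
    also have "\<dots> = real B * 2 ^ k"
      by simp
    also have "\<dots> \<le> (real n / (2 ^ k * D n) + 1) * 2 ^ k"
    proof (rule mult_right_mono)
      have "0 \<le> real n / (2 ^ k * D n)"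
        using elim(1) by simp
      then have "0 \<le> \<lceil>real n / (2 ^ k * D n)\<rceil>"
        unfolding zero_le_ceiling by linarith
      then show "real B \<le> real n / (2 ^ k * D n) + 1"
        unfolding B_def using of_int_ceiling_le_add_one[of "real n / (2 ^ k * D n)"] by simp
    qed simp
    also have "\<dots> = real n / D n + 2 ^ k"
      using elim(1) by (simp add: field_simps)
    also have "2 ^ k \<le> real n / ln (real n) ^ 2"
    proof -
      have "(2::real) ^ k = 2 powr real k"
        by (simp add: powr_realpow)
      also have "\<dots> \<le> 2 powr L n"
        using k(1) by simp
      also have "\<dots> = real n / ln (real n) ^ 2"
        using lnn elim(3) by (simp add: L_def log_def[symmetric])
      finally show ?thesis .
    qed
    finally have "?dim n \<le> real n * (1 / D n + 1 / ln (real n) ^ 2)"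
      by (simp add: algebra_simps)
    then have "?dim n * log ?r (real n)
        \<le> real n * (1 / D n + 1 / ln (real n) ^ 2) * log ?r (real n)"
      using r elim(3) by (intro mult_right_mono) auto
    then have "?dim n * log ?r (real n) / real n - 2 \<le> E n"
      using elim(3) by (simp add: E_def log_r pos_divide_le_eq algebra_simps)
    then show "\<bar>f n\<bar> \<le> \<bar>E n\<bar>"
      by (simp add: f_def)
  qed
  then have "f \<in> O(E)"
    by (intro landau_o.big_mono) simp
  also have "E \<in> O(\<lambda>n. ln (ln (real n)) / ln (real n))"
    unfolding E_def D_def L_def using \<open>c > 0\<close> by (rule blocking_error_bigo)
  finally have "f \<in> O(\<lambda>n. ln (ln (real n)) / ln (real n))" .
  moreover have "?dim n \<le> (2 + f n) * (real n / log ?r (real n))" if "n \<ge> 2" for n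
  proof -
    have "log ?r (real n) > 0"
      using r that by simp
    moreover have "?dim n * log ?r (real n) / real n \<le> 2 + f n"
      by (simp add: f_def)
    ultimately show ?thesis
      using that by (simp add: field_simps)
  qed
  ultimately show ?thesis
    by blast
qed

end
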